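(* Let $f\in\mathcal{A}$ be ergodic with respect to Lebesgue measure. Then for every $n\ge1$, the subgraph $H_n(f)$ of $G_n$ contains a partially driftless loop.
   Context: $I=[0,1]$, $[n]=\{1,\dots,n\}$. For distinct reals $y_1,\dots,y_n$, $\mathrm{Order}(y_1,\dots,y_n)$ is the unique $\sigma\in S_n$ with $y_i<y_j$ iff $\sigma(i)<\sigma(j)$. $\rho,\rho':S_{n+1}\to S_n$: $\rho(\sigma)=\mathrm{Order}(\sigma(1),\dots,\sigma(n))$, $\rho'(\sigma)=\mathrm{Order}(\sigma(2),\dots,\sigma(n+1))$. $\mathcal{A}$ is the set of $f:I\to I$ such that Lebesgue-almost every $x$ has infinite orbit. $\boldsymbol{\sigma}_{m}(f)\subseteq S_{m}$ is the set of $\mathrm{Order}(x,f(x),\dots,f^{m-1}(x))$ over $x$ with infinite orbit. The permutation digraph $G_n$ has vertex set $S_n$ and edge set $S_{n+1}$, the edge $e$ directed from $\rho(e)$ to $\rho'(e)$. $H_n(f)$ is the subgraph of $G_n$ with edge set $\boldsymbol{\sigma}_{n+1}(f)$ (together with the endpoints of these edges). A path of length $\ell$ is $(v_0,e_1,v_1,\dots,e_\ell,v_\ell)$ with $e_i$ directed from $v_{i-1}$ to $v_i$; a loop is a finite path with $v_\ell=v_0$. For a path $p$ of length $\ell$ let $Q_p=\{x_1,\dots,x_{\ell+n}\}$ with $\le$ the reflexive-transitive closure of: $x_{a+c}\le x_{a+d}$ when $0\le a\le\ell$, $c,d\in[n]$, $v_a(c)\le v_a(d)$; $x_{a-1+c}\le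 x_{a-1+d}$ when $1\le a\le\ell$, $c,d\in[n+1]$, $e_a(c)\le e_a(d)$. For a loop $\gamma$ of length $\ell\ge1$, $\mathrm{Drift}_\gamma(i)=+$ if $x_i\le x_{\ell+i}$, $-$ if $x_i\ge x_{\ell+i}$, $0$ otherwise; $\gamma$ is partially driftless if $\mathrm{Drift}_\gamma(i)=0$ for some $i\in[n]$. *)

theory Defs
  imports "HOL-Analysis.Analysis" "HOL-Combinatorics.Permutations" "Graph_Theory.Digraph_Component"
begin

text \<open>
  An element of $S_n$ is a function \<open>\<sigma> :: nat \<Rightarrow> nat\<close> with \<open>\<sigma> permutes {1..n}\<close>. A tuple
  $y_1,\dots,y_n$ is a function on \<open>nat\<close> of which only the values at \<open>1, \<dots>, n\<close> matter. These
  values may lie in any linear order, so that the same operator applies to tuples of reals and to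
  segments of a permutation.
\<close>

definition Order :: "nat \<Rightarrow> (nat \<Rightarrow> 'a::linorder) \<Rightarrow> (nat \<Rightarrow> nat)" where
  "Order n y = (THE \<sigma>. \<sigma> permutes {1..n} \<and>
     (\<forall>i\<in>{1..n}. \<forall>j\<in>{1..n}. y i < y j \<longleftrightarrow> \<sigma> i < \<sigma> j))"

definition rho :: "nat \<Rightarrow> (nat \<Rightarrow> nat) \<Rightarrow> (nat \<Rightarrow> nat)" where
  "rho n \<sigma> = Order n (\<lambda>i. \<sigma> i)"

definition rho' :: "nat \<Rightarrow> (nat \<Rightarrow> nat) \<Rightarrow> (nat \<Rightarrow> nat)" where
  "rho' n \<sigma> = Order n (\<lambda>i. \<sigma> (i + 1))"

definition orbit :: "('a \<Rightarrow> 'a) \<Rightarrow> 'a \<Rightarrow> 'a set" where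
  "orbit f x = {(f ^^ k) x | k. True}"

text \<open>
  Maps $I \to I$ are functions on the reals that map \<open>{0..1}\<close> to itself; their values elsewhere
  play no role.
\<close>

definition class_A :: "(real \<Rightarrow> real) set" where
  "class_A = {f. f \<in> {0..1} \<rightarrow> {0..1} \<and> (AE x in lebesgue_on {0..1}. infinite (orbit f x))}"

definition patterns :: "nat \<Rightarrow> (real \<Rightarrow> real) \<Rightarrow> (nat \<Rightarrow> nat) set" where
  "patterns m f = {Order m (\<lambda>i. (f ^^ (i - 1)) x) | x. x \<in> {0..1} \<and> infinite (orbit f x)}"

text \<open>
  Ergodicity with respect to a measure includes that the measure is invariant.
\<close>

definition ergodic :: "'a measure \<Rightarrow> ('a \<Rightarrow> 'a) \<Rightarrow> bool" where
  "ergodic M T \<longleftrightarrow> T \<in> measurable M M \<and> distr M M T = M \<and>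
     (\<forall>A\<in>sets M. T -` A \<inter> space M = A \<longrightarrow> A \<in> null_sets M \<or> space M - A \<in> null_sets M)"

definition perm_digraph :: "nat \<Rightarrow> (nat \<Rightarrow> nat, nat \<Rightarrow> nat) pre_digraph" where
  "perm_digraph n = \<lparr> verts = {\<sigma>. \<sigma> permutes {1..n}}, arcs = {\<sigma>. \<sigma> permutes {1..n+1}},
     tail = rho n, head = rho' n \<rparr>"

definition pattern_digraph :: "nat \<Rightarrow> (real \<Rightarrow> real) \<Rightarrow> (nat \<Rightarrow> nat, nat \<Rightarrow> nat) pre_digraph" where
  "pattern_digraph n f = \<lparr> verts = rho n ` patterns (n+1) f \<union> rho' n ` patterns (n+1) f,
     arcs = patterns (n+1) f, tail = rho n, head = rho' n \<rparr>"

text \<open>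
  A path $(v_0,e_1,v_1,\dots,e_\ell,v_\ell)$ is given, as in the theory of arc walks, by its initial
  vertex \<open>u\<close> and its list \<open>es\<close> of arcs. With this 0-based indexing, $v_a$ is \<open>path_verts n u es ! a\<close>
  and $e_a$ is \<open>es ! (a - 1)\<close>.
\<close>

abbreviation path_verts :: "nat \<Rightarrow> (nat \<Rightarrow> nat) \<Rightarrow> (nat \<Rightarrow> nat) list \<Rightarrow> (nat \<Rightarrow> nat) list" where
  "path_verts n u es \<equiv> pre_digraph.awalk_verts (perm_digraph n) u es"

definition is_loop :: "(nat \<Rightarrow> nat, nat \<Rightarrow> nat) pre_digraph \<Rightarrow> (nat \<Rightarrow> nat) \<Rightarrow> (nat \<Rightarrow> nat) list \<Rightarrow> bool" where
  "is_loop G u es \<longleftrightarrow> pre_digraph.awalk G u es u"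

text \<open>
  The element $x_i$ of $Q_p$ is represented by its index \<open>i\<close>.
\<close>

definition path_gen :: "nat \<Rightarrow> (nat \<Rightarrow> nat) \<Rightarrow> (nat \<Rightarrow> nat) list \<Rightarrow> (nat \<times> nat) set" where
  "path_gen n u es =
     {(a + c, a + d) | a c d. a \<le> length es \<and> c \<in> {1..n} \<and> d \<in> {1..n} \<and>
        (path_verts n u es ! a) c \<le> (path_verts n u es ! a) d} \<union>
     {(a - 1 + c, a - 1 + d) | a c d. 1 \<le> a \<and> a \<le> length es \<and> c \<in> {1..n+1} \<and> d \<in> {1..n+1} \<and>
        (es ! (a - 1)) c \<le> (es ! (a - 1)) d}"

definition path_order :: "nat \<Rightarrow> (nat \<Rightarrow> nat) \<Rightarrow> (nat \<Rightarrow> nat) list \<Rightarrow> (nat \<times> nat) set" where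
  "path_order n u es =
     (path_gen n u es)\<^sup>* \<inter> ({1..length es + n} \<times> {1..length es + n})"

datatype drift_sign = Drift_Pos | Drift_Neg | Drift_Zero

definition drift :: "nat \<Rightarrow> (nat \<Rightarrow> nat) \<Rightarrow> (nat \<Rightarrow> nat) list \<Rightarrow> nat \<Rightarrow> drift_sign" where
  "drift n u es i =
     (if (i, length es + i) \<in> path_order n u es then Drift_Pos
      else if (length es + i, i) \<in> path_order n u es then Drift_Neg
      else Drift_Zero)"

definition partially_driftless :: "nat \<Rightarrow> (nat \<Rightarrow> nat) \<Rightarrow> (nat \<Rightarrow> nat) list \<Rightarrow> bool" where
  "partially_driftless n u es \<longleftrightarrow> 1 \<le> length es \<and> (\<exists>i\<in>{1..n}. drift n u es i = Drift_Zero)"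

lemma Order_ex1:
  fixes y :: "nat \<Rightarrow> 'a::linorder"
  assumes inj: "inj_on y {1..n}"
  shows "\<exists>!\<sigma>. \<sigma> permutes {1..n} \<and>
     (\<forall>i\<in>{1..n}. \<forall>j\<in>{1..n}. y i < y j \<longleftrightarrow> \<sigma> i < \<sigma> j)"
proof (rule ex_ex1I)
  define s where "s = (\<lambda>i. if i \<in> {1..n} then card {j\<in>{1..n}. y j \<le> y i} else i)"
  have less: "s i < s j" if "i \<in> {1..n}" "j \<in> {1..n}" "y i < y j" for i j
  proof -
    have "{k\<in>{1..n}. y k \<le> y i} \<subset> {k\<in>{1..n}. y k \<le> y j}"
    proof (rule psubsetI)
      show "{k\<in>{1..n}. y k \<le> y i} \<subseteq> {k\<in>{1..n}. y k \<le> y j}" using that by auto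
      have "j \<in> {k\<in>{1..n}. y k \<le> y j}" "j \<notin> {k\<in>{1..n}. y k \<le> y i}" using that by auto
      then show "{k\<in>{1..n}. y k \<le> y i} \<noteq> {k\<in>{1..n}. y k \<le> y j}" by blast
    qed
    then show ?thesis using that by (simp add: s_def psubset_card_mono)
  qed
  have iff: "y i < y j \<longleftrightarrow> s i < s j" if "i \<in> {1..n}" "j \<in> {1..n}" for i j
    using less[of i j] less[of j i] that by (metis linorder_cases order.asym less_irrefl inj_onD[OF inj])
  have "inj_on s {1..n}"
    by (intro inj_onI) (metis iff inj_onD[OF inj] linorder_cases less_irrefl)
  moreover have "s ` {1..n} \<subseteq> {1..n}"
  proof
    fix k assume "k \<in> s ` {1..n}"
    then obtain i where i: "i \<in> {1..n}" "k = s i" by blast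
    have "card {j\<in>{1..n}. y j \<le> y i} \<le> card {1..n}" by (rule card_mono) auto
    moreover have "card {j\<in>{1..n}. y j \<le> y i} > 0" using i by (auto simp: card_gt_0_iff)
    ultimately show "k \<in> {1..n}" using i by (simp add: s_def)
  qed
  ultimately have "bij_betw s {1..n} {1..n}"
    by (simp add: bij_betw_def endo_inj_surj)
  then have "s permutes {1..n}"
    by (rule bij_imp_permutes) (auto simp: s_def)
  with iff show "\<exists>\<sigma>. \<sigma> permutes {1..n} \<and>
     (\<forall>i\<in>{1..n}. \<forall>j\<in>{1..n}. y i < y j \<longleftrightarrow> \<sigma> i < \<sigma> j)" by blast
next
  fix \<sigma> \<tau> :: "nat \<Rightarrow> nat"
  assume \<sigma>: "\<sigma> permutes {1..n} \<and> (\<forall>i\<in>{1..n}. \<forall>j\<in>{1..n}. y i < y j \<longleftrightarrow> \<sigma> i < \<sigma> j)"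
    and \<tau>: "\<tau> permutes {1..n} \<and> (\<forall>i\<in>{1..n}. \<forall>j\<in>{1..n}. y i < y j \<longleftrightarrow> \<tau> i < \<tau> j)"
  have rank: "\<phi> i = card {j\<in>{1..n}. y j < y i} + 1"
    if \<phi>: "\<phi> permutes {1..n} \<and> (\<forall>i\<in>{1..n}. \<forall>j\<in>{1..n}. y i < y j \<longleftrightarrow> \<phi> i < \<phi> j)"
      and i: "i \<in> {1..n}" for \<phi> :: "nat \<Rightarrow> nat" and i
  proof -
    have im: "\<phi> ` {1..n} = {1..n}" using \<phi> permutes_image by blast
    then have "\<phi> i \<in> {1..n}" using i by blast
    have less_iff: "y j < y i \<longleftrightarrow> \<phi> j < \<phi> i" if "j \<in> {1..n}" for j
      using \<phi> i that by blast
    have "\<phi> ` {j\<in>{1..n}. y j < y i} = {1..<\<phi> i}"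
    proof (intro set_eqI iffI)
      fix k assume "k \<in> \<phi> ` {j\<in>{1..n}. y j < y i}"
      then obtain j where j: "j \<in> {1..n}" "y j < y i" "k = \<phi> j" by blast
      then have "\<phi> j \<in> {1..n}" using im by blast
      then show "k \<in> {1..<\<phi> i}" using j less_iff[of j] by simp
    next
      fix k assume k: "k \<in> {1..<\<phi> i}"
      then have "k \<in> {1..n}" using \<open>\<phi> i \<in> {1..n}\<close> by simp
      then have "k \<in> \<phi> ` {1..n}" using im by (simp only:)
      then obtain j where j: "j \<in> {1..n}" "k = \<phi> j" by blast
      then have "y j < y i" using less_iff[of j] k by simp
      then show "k \<in> \<phi> ` {j\<in>{1..n}. y j < y i}" using j by blast
    qed
    moreover have "inj_on \<phi> {j\<in>{1..n}. y j < y i}"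
      using \<phi> permutes_inj_on by blast
    ultimately have "card {j\<in>{1..n}. y j < y i} = card {1..<\<phi> i}"
      by (metis card_image)
    then show ?thesis using \<open>\<phi> i \<in> {1..n}\<close> by simp
  qed
  show "\<sigma> = \<tau>"
  proof
    fix i
    show "\<sigma> i = \<tau> i"
    proof (cases "i \<in> {1..n}")
      case True
      then show ?thesis using rank[OF \<sigma> True] rank[OF \<tau> True] by (simp only:)
    next
      case False
      then show ?thesis using \<sigma> \<tau> by (metis permutes_not_in)
    qed
  qed
qed

lemma Order_permutes: "inj_on y {1..n} \<Longrightarrow> Order n y permutes {1..n}"
  unfolding Order_def using theI'[OF Order_ex1] by blast

lemma inj_on_orbit:
  assumes "infinite (orbit f x)"
  shows "inj (\<lambda>k. (f ^^ k) x)"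
proof (rule ccontr)
  assume "\<not> inj (\<lambda>k. (f ^^ k) x)"
  then obtain a b where "a \<noteq> b" "(f ^^ a) x = (f ^^ b) x" by (auto simp: inj_def)
  then obtain a b where ab: "a < b" "(f ^^ a) x = (f ^^ b) x"
    by (metis nat_neq_iff)
  have "(f ^^ k) x \<in> (\<lambda>k. (f ^^ k) x) ` {..<b}" for k
  proof (induction k rule: less_induct)
    case (less k)
    show ?case
    proof (cases "k < b")
      case False
      then have "(f ^^ k) x = (f ^^ (k - b)) ((f ^^ b) x)"
        by (metis funpow_add le_add_diff_inverse2 linorder_not_less o_apply)
      also have "\<dots> = (f ^^ (k - b + a)) x" by (simp add: ab(2)[symmetric] funpow_add)
      finally show ?thesis using less[of "k - b + a"] ab(1) False by simp
    qed auto
  qed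
  then have "orbit f x \<subseteq> (\<lambda>k. (f ^^ k) x) ` {..<b}" by (auto simp: orbit_def)
  then show False using assms finite_subset by blast
qed

lemma patterns_permutes:
  assumes "\<sigma> \<in> patterns m f"
  shows "\<sigma> permutes {1..m}"
proof -
  obtain x where x: "infinite (orbit f x)" and \<sigma>: "\<sigma> = Order m (\<lambda>i. (f ^^ (i - 1)) x)"
    using assms by (auto simp: patterns_def)
  have "inj_on (\<lambda>i. (f ^^ (i - 1)) x) {1..m}"
  proof (rule inj_onI)
    fix i j assume "i \<in> {1..m}" "j \<in> {1..m}" "(f ^^ (i - 1)) x = (f ^^ (j - 1)) x"
    then have "i - 1 = j - 1" using inj_on_orbit[OF x] by (auto dest: injD)
    then show "i = j" using \<open>i \<in> {1..m}\<close> \<open>j \<in> {1..m}\<close> by auto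
  qed
  then show ?thesis unfolding \<sigma> by (rule Order_permutes)
qed

lemma wf_perm_digraph: "wf_digraph (perm_digraph n)"
proof
  fix e assume "e \<in> arcs (perm_digraph n)"
  then have "inj e" by (simp add: perm_digraph_def permutes_inj)
  then have "inj_on e {1..n}" "inj_on (\<lambda>i. e (i + 1)) {1..n}"
    by (auto simp: inj_on_def inj_def)
  then have "rho n e permutes {1..n}" "rho' n e permutes {1..n}"
    unfolding rho_def rho'_def by (auto simp only: intro!: Order_permutes)
  then show "tail (perm_digraph n) e \<in> verts (perm_digraph n)"
    "head (perm_digraph n) e \<in> verts (perm_digraph n)"
    by (simp_all add: perm_digraph_def)
qed

lemma subgraph_pattern_digraph: "subgraph (pattern_digraph n f) (perm_digraph n)"
proof -
  have arcs: "patterns (n+1) f \<subseteq> arcs (perm_digraph n)"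
    using patterns_permutes by (auto simp: perm_digraph_def simp del: One_nat_def)
  interpret wf_digraph "perm_digraph n" by (rule wf_perm_digraph)
  have "verts (pattern_digraph n f) \<subseteq> verts (perm_digraph n)"
  proof -
    have "rho n e \<in> verts (perm_digraph n) \<and> rho' n e \<in> verts (perm_digraph n)"
      if "e \<in> patterns (n+1) f" for e
      using tail_in_verts[of e] head_in_verts[of e] arcs that
      by (simp add: perm_digraph_def subset_iff)
    then show ?thesis by (simp add: pattern_digraph_def image_subset_iff)
  qed
  moreover have "wf_digraph (pattern_digraph n f)"
    by unfold_locales (auto simp: pattern_digraph_def)
  ultimately show ?thesis
    using arcs wf_perm_digraph
    by (auto simp: subgraph_def compatible_def pattern_digraph_def perm_digraph_def)
qed

end

theory Submission
  imports Defs
begin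

text \<open>
  Call a point low if it is below $1/(n+1)$. By ergodicity, almost every orbit visits
  infinitely often both the set of low points and the set of points that start $n$ consecutive
  non-low iterates; the latter has positive measure by a union bound. Since there are finitely many
  order patterns of length $n$, such an orbit has two low points with the same pattern and with $n$
  consecutive non-low iterates strictly in between. The stretch of orbit between the two is a loop.
  A generating relation of its order joins times that differ by at most $n$, so a chain joining the
  two ends has to enter the non-low window, although its values lie between those of two low points.
\<close>

section \<open>Recurrence\<close>

lemma funpow_measure_preserving:
  assumes "T \<in> measurable M M" and "distr M M T = M"
  shows "T ^^ k \<in> measurable M M \<and> distr M M (T ^^ k) = M"
proof (induction k)
  case 0
  show ?case by (auto simp: id_def)
next
  case (Suc k)
  then have "distr M M (T \<circ> (T ^^ k)) = distr (distr M M (T ^^ k)) M T"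
    by (subst distr_distr) (use assms in auto)
  then show ?case using Suc assms by (auto simp: comp_def)
qed

lemma emeasure_funpow_vimage:
  assumes "T \<in> measurable M M" and "distr M M T = M" and "U \<in> sets M"
  shows "emeasure M ((T ^^ k) -` U \<inter> space M) = emeasure M U"
  using funpow_measure_preserving[OF assms(1,2), of k] assms(3) by (metis emeasure_distr)

text \<open>The points that visit \<open>U\<close> infinitely often form the limsup of its
  preimages. By invariance each tail union has at least the measure of \<open>U\<close>, so
  continuity from above makes the limsup non-null. It is strictly invariant, hence conull.\<close>

lemma ergodic_visits_infinitely_often:
  assumes erg: "ergodic M T" and "finite_measure M"
    and U: "U \<in> sets M" and pos: "emeasure M U > 0"
  shows "AE x in M. \<exists>\<^sub>F k in sequentially. (T ^^ k) x \<in> U"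
proof -
  interpret finite_measure M by fact
  have T: "T \<in> measurable M M" and D: "distr M M T = M"
    and inv: "\<And>A. A \<in> sets M \<Longrightarrow> T -` A \<inter> space M = A \<Longrightarrow>
      A \<in> null_sets M \<or> space M - A \<in> null_sets M"
    using erg by (auto simp: ergodic_def)
  define V where "V k = (T ^^ k) -` U \<inter> space M" for k
  have V: "V k \<in> sets M" for k
    using funpow_measure_preserving[OF T D, of k] U by (auto simp: V_def)
  define W where "W m = (\<Union>k\<in>{m..}. V k)" for m
  have W: "W m \<in> sets M" for m using V by (auto simp: W_def)
  define E where "E = (\<Inter>m. W m)"
  have E: "E \<in> sets M" using W by (auto simp: E_def)
  have E_iff: "x \<in> E \<longleftrightarrow> x \<in> space M \<and> (\<exists>\<^sub>F k in sequentially. (T ^^ k) x \<in> U)" for x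
    by (auto simp: E_def W_def V_def frequently_sequentially)
  have "emeasure M U \<le> emeasure M (W m)" for m
    using emeasure_funpow_vimage[OF T D U, of m] emeasure_mono[OF _ W, of "V m" m]
    by (auto simp: W_def V_def)
  then have "emeasure M U \<le> (INF m. emeasure M (W m))" by (auto intro: INF_greatest)
  also have "\<dots> = emeasure M E"
    unfolding E_def
    by (rule INF_emeasure_decseq) (use W in \<open>auto simp: decseq_def W_def intro: order_trans\<close>)
  finally have "E \<notin> null_sets M" using pos by auto
  moreover have "T -` E \<inter> space M = E"
  proof -
    \<comment> \<open>Passing from \<open>x\<close> to \<open>T x\<close> shifts the visiting times
      by one, which does not change whether there are infinitely many.\<close>
    have "(\<exists>\<^sub>F k in sequentially. (T ^^ k) (T x) \<in> U) \<longleftrightarrow>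
        (\<exists>\<^sub>F k in sequentially. (T ^^ k) x \<in> U)" for x
      using eventually_sequentially_Suc[of "\<lambda>k. (T ^^ k) x \<notin> U"]
      by (simp add: frequently_def funpow_Suc_right del: funpow.simps)
    then show ?thesis using measurable_space[OF T] by (auto simp: E_iff)
  qed
  ultimately have "space M - E \<in> null_sets M" using inv E by blast
  then show ?thesis by (rule AE_I') (auto simp: E_iff)
qed

lemma emeasure_lebesgue_unit: "emeasure (lebesgue_on {0..1::real}) {0..<c} = ennreal c"
  if "0 \<le> c" "c \<le> 1" for c
  using that by (subst emeasure_restrict_space) (auto simp: Int_absorb2 subset_iff)

text \<open>Each of the \<open>n\<close> preimages of \<open>{0..<c}\<close> has measure
  \<open>c\<close>, so together they leave a set of positive measure, to which recurrence
  applies.\<close>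

lemma ergodic_unit_interval_avoids:
  fixes f :: "real \<Rightarrow> real"
  assumes erg: "ergodic (lebesgue_on {0..1}) f" and c: "0 \<le> c" "real n * c < 1"
  shows "AE x in lebesgue_on {0..1}. \<exists>\<^sub>F k in sequentially. \<forall>i<n. (f ^^ (k + i)) x \<ge> c"
proof (cases "n = 0")
  case False
  define M where "M = lebesgue_on {0..1::real}"
  have sp: "space M = {0..1}" by (simp add: M_def)
  have "1 * c \<le> real n * c" using False c by (intro mult_right_mono) auto
  then have c1: "c \<le> 1" using c by simp
  interpret finite_measure M
    by standard (simp add: M_def emeasure_restrict_space)
  have f: "f \<in> measurable M M" and D: "distr M M f = M"
    using erg by (auto simp: ergodic_def M_def)
  have J: "{0..<c} \<in> sets M" using c1 by (auto simp: M_def sets_restrict_space_iff)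
  define N where "N i = (f ^^ i) -` {0..<c} \<inter> space M" for i
  have N: "N i \<in> sets M" for i
    using funpow_measure_preserving[OF f D, of i] J by (auto simp: N_def)
  have "emeasure M (\<Union>i<n. N i) \<le> (\<Sum>i<n. emeasure M (N i))"
    by (rule emeasure_subadditive_finite) (use N in auto)
  also have "\<dots> = (\<Sum>i<n. ennreal c)"
    using emeasure_funpow_vimage[OF f D J] emeasure_lebesgue_unit[OF c(1) c1]
    by (simp add: N_def M_def)
  also have "\<dots> = ennreal (real n * c)" using c by (simp add: ennreal_mult ennreal_of_nat_eq_real_of_nat)
  also have "\<dots> < ennreal 1" using c by (subst ennreal_less_iff) auto
  also have "ennreal 1 = emeasure M (space M)" by (simp add: M_def emeasure_restrict_space)
  finally have less: "emeasure M (\<Union>i<n. N i) < emeasure M (space M)" .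
  define B where "B = space M - (\<Union>i<n. N i)"
  have B: "B \<in> sets M" using N by (auto simp: B_def)
  have "emeasure M B > 0"
    using less emeasure_compl[of "\<Union>i<n. N i" M] N by (auto simp: B_def diff_gr0_ennreal)
  then have "AE x in M. \<exists>\<^sub>F k in sequentially. (f ^^ k) x \<in> B"
    using erg B by (intro ergodic_visits_infinitely_often finite_measure_axioms) (auto simp: M_def)
  then show ?thesis
    unfolding M_def[symmetric]
  proof eventually_elim
    case (elim x)
    then show ?case
    proof (rule frequently_elim1)
      fix k assume k: "(f ^^ k) x \<in> B"
      show "\<forall>i<n. (f ^^ (k + i)) x \<ge> c"
      proof (intro allI impI)
        fix i assume "i < n"
        then have "(f ^^ i) ((f ^^ k) x) \<notin> {0..<c}" using k by (auto simp: B_def N_def)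
        \<comment> \<open>Avoiding \<open>{0..<c}\<close> gives the lower bound only together with
          nonnegativity, which comes from staying in the space.\<close>
        moreover have "(f ^^ i) ((f ^^ k) x) \<in> space M"
          using k funpow_measure_preserving[OF f D, of i] by (auto simp: B_def dest: measurable_space)
        ultimately show "(f ^^ (k + i)) x \<ge> c"
          by (simp add: sp add.commute[of k] funpow_add)
      qed
    qed
  qed
qed auto

section \<open>Orbits as walks\<close>

lemma Order_less_iff:
  assumes "inj_on y {1..n}" "i \<in> {1..n}" "j \<in> {1..n}"
  shows "Order n y i < Order n y j \<longleftrightarrow> y i < y j"
  using theI'[OF Order_ex1[OF assms(1)]] assms(2,3) unfolding Order_def by blast

lemma Order_le_iff:
  assumes "inj_on y {1..n}" "i \<in> {1..n}" "j \<in> {1..n}"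
  shows "Order n y i \<le> Order n y j \<longleftrightarrow> y i \<le> y j"
  using Order_less_iff[OF assms(1,3,2)] by (simp add: linorder_not_less[symmetric])

lemma Order_cong:
  assumes "\<And>i j. i \<in> {1..n} \<Longrightarrow> j \<in> {1..n} \<Longrightarrow> y i < y j \<longleftrightarrow> z i < z j"
  shows "Order n y = Order n z"
proof -
  have "(\<forall>i\<in>{1..n}. \<forall>j\<in>{1..n}. y i < y j \<longleftrightarrow> \<sigma> i < \<sigma> j) \<longleftrightarrow>
      (\<forall>i\<in>{1..n}. \<forall>j\<in>{1..n}. z i < z j \<longleftrightarrow> \<sigma> i < \<sigma> j)" for \<sigma> :: "nat \<Rightarrow> nat"
    by (intro ball_cong refl) (simp only: assms)
  then show ?thesis by (simp only: Order_def)
qed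

text \<open>\<open>Order\<close> keeps every comparison, so standardizing a segment of the
  standardized tuple amounts to standardizing that segment of \<open>y\<close>.\<close>

lemma rho_Order:
  assumes "inj_on y {1..n+1}"
  shows "rho n (Order (n+1) y) = Order n y"
  unfolding rho_def by (rule Order_cong, rule Order_less_iff[OF assms]) auto

lemma rho'_Order:
  assumes "inj_on y {1..n+1}"
  shows "rho' n (Order (n+1) y) = Order n (\<lambda>i. y (i + 1))"
  unfolding rho'_def by (rule Order_cong, rule Order_less_iff[OF assms]) auto

definition orbit_order :: "nat \<Rightarrow> ('a::linorder \<Rightarrow> 'a) \<Rightarrow> 'a \<Rightarrow> nat \<Rightarrow> nat" where
  "orbit_order n f x = Order n (\<lambda>i. (f ^^ (i - 1)) x)"

text \<open>Consecutive entries overlap in \<open>n\<close> iterates, so these are the arcs of a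
  walk through the patterns of length \<open>n\<close> at \<open>x\<close>, \<open>f x\<close> and
  so on.\<close>

definition orbit_arcs :: "nat \<Rightarrow> ('a::linorder \<Rightarrow> 'a) \<Rightarrow> 'a \<Rightarrow> nat \<Rightarrow> (nat \<Rightarrow> nat) list" where
  "orbit_arcs n f x l = map (\<lambda>a. orbit_order (n+1) f ((f ^^ a) x)) [0..<l]"

lemma inj_on_orbit_segment:
  assumes "infinite (orbit f x)"
  shows "inj_on (\<lambda>i. (f ^^ (i - 1)) x) {1..n}"
proof (rule inj_onI)
  fix i j assume "i \<in> {1..n}" "j \<in> {1..n}" "(f ^^ (i - 1)) x = (f ^^ (j - 1)) x"
  then show "i = j" using injD[OF inj_on_orbit[OF assms]] by fastforce
qed

lemma infinite_orbit_funpow: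
  assumes "infinite (orbit f x)"
  shows "infinite (orbit f ((f ^^ k) x))"
proof -
  have "inj (\<lambda>j. (f ^^ (j + k)) x)"
    using inj_on_orbit[OF assms] unfolding inj_def by (metis add_right_cancel)
  then have "infinite (range (\<lambda>j. (f ^^ (j + k)) x))" by (rule range_inj_infinite)
  moreover have "range (\<lambda>j. (f ^^ (j + k)) x) = orbit f ((f ^^ k) x)"
    by (auto simp: orbit_def funpow_add)
  ultimately show ?thesis by simp
qed

lemma orbit_order_permutes:
  "infinite (orbit f x) \<Longrightarrow> orbit_order n f x permutes {1..n}"
  unfolding orbit_order_def by (intro Order_permutes inj_on_orbit_segment)

text \<open>This is the dictionary for path orders: the index \<open>a + c\<close> stands for the
  iterate with exponent \<open>a + c - 1\<close>.\<close>

lemma orbit_order_le_iff: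
  assumes "infinite (orbit f x)" "c \<in> {1..n}" "d \<in> {1..n}"
  shows "orbit_order n f ((f ^^ a) x) c \<le> orbit_order n f ((f ^^ a) x) d \<longleftrightarrow>
    (f ^^ (a + c - 1)) x \<le> (f ^^ (a + d - 1)) x"
proof -
  have "(f ^^ (i - 1)) ((f ^^ a) x) = (f ^^ (a + i - 1)) x" if "i \<in> {1..n}" for i
    using that funpow_add[of "i - 1" a f] by (simp add: add.commute)
  then show ?thesis
    unfolding orbit_order_def
    using Order_le_iff[OF inj_on_orbit_segment[OF infinite_orbit_funpow[OF assms(1)]] assms(2,3)] assms
    by simp
qed

lemma rho_orbit_order:
  "infinite (orbit f x) \<Longrightarrow> rho n (orbit_order (n+1) f x) = orbit_order n f x"
  unfolding orbit_order_def by (intro rho_Order inj_on_orbit_segment)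

lemma rho'_orbit_order:
  assumes "infinite (orbit f x)"
  shows "rho' n (orbit_order (n+1) f x) = orbit_order n f (f x)"
proof -
  have "rho' n (orbit_order (n+1) f x) = Order n (\<lambda>i. (f ^^ (i + 1 - 1)) x)"
    unfolding orbit_order_def using rho'_Order[OF inj_on_orbit_segment[OF assms]] .
  also have "\<dots> = orbit_order n f (f x)"
    unfolding orbit_order_def
  proof (rule Order_cong)
    \<comment> \<open>Truncated subtraction makes this false in general at \<open>i = 0\<close>;
      tuples start at 1.\<close>
    have "(f ^^ (i + 1 - 1)) x = (f ^^ (i - 1)) (f x)" if "i \<in> {1..n}" for i
      using that by (cases i) (auto simp: funpow_Suc_right simp del: funpow.simps)
    then show "(f ^^ (i + 1 - 1)) x < (f ^^ (j + 1 - 1)) x \<longleftrightarrow>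
        (f ^^ (i - 1)) (f x) < (f ^^ (j - 1)) (f x)"
      if "i \<in> {1..n}" "j \<in> {1..n}" for i j using that by (simp only:)
  qed
  finally show ?thesis .
qed

lemma orbit_arcs_Suc:
  "orbit_arcs n f x (Suc l) = orbit_order (n+1) f x # orbit_arcs n f (f x) l"
  unfolding orbit_arcs_def
  by (simp add: upt_conv_Cons funpow_swap1 del: upt_Suc flip: map_Suc_upt)

lemma orbit_cas:
  assumes "infinite (orbit f x)" "tail G = rho n" "head G = rho' n"
  shows "pre_digraph.cas G (orbit_order n f x) (orbit_arcs n f x l) (orbit_order n f ((f ^^ l) x))"
  using assms(1)
proof (induction l arbitrary: x)
  case 0
  show ?case by (simp add: orbit_arcs_def pre_digraph.cas.simps)
next
  case (Suc l)
  have "infinite (orbit f (f x))" using infinite_orbit_funpow[OF Suc.prems, of 1] by simp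
  from Suc.IH[OF this] show ?case
    using assms(2,3) rho_orbit_order[OF Suc.prems, of n] rho'_orbit_order[OF Suc.prems, of n]
    unfolding orbit_arcs_Suc by (simp add: pre_digraph.cas.simps funpow_swap1)
qed

text \<open>\<open>path_verts\<close> is computed in \<open>perm_digraph\<close>, but depends only
  on tail and head, which \<open>pattern_digraph\<close> shares.\<close>

lemma path_verts_orbit_arcs:
  assumes "infinite (orbit f x)" "a \<le> l"
  shows "path_verts n (orbit_order n f x) (orbit_arcs n f x l) ! a = orbit_order n f ((f ^^ a) x)"
  using assms
proof (induction l arbitrary: x a)
  case 0
  then show ?case by (simp add: orbit_arcs_def pre_digraph.awalk_verts.simps)
next
  case (Suc l)
  have inf: "infinite (orbit f (f x))" using infinite_orbit_funpow[OF Suc.prems(1), of 1] by simp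
  show ?case
    using Suc.IH[OF inf] Suc.prems rho_orbit_order[OF Suc.prems(1), of n]
      rho'_orbit_order[OF Suc.prems(1), of n]
    unfolding orbit_arcs_Suc
    by (cases a) (auto simp: pre_digraph.awalk_verts.simps perm_digraph_def funpow_swap1)
qed

lemma awalk_orbit:
  fixes f :: "real \<Rightarrow> real"
  assumes "f \<in> {0..1} \<rightarrow> {0..1}" "x \<in> {0..1}" "infinite (orbit f x)" "l \<ge> 1"
  shows "pre_digraph.awalk (pattern_digraph n f) (orbit_order n f x) (orbit_arcs n f x l)
    (orbit_order n f ((f ^^ l) x))"
proof -
  have "(f ^^ k) x \<in> {0..1}" for k
    by (induction k) (use assms(1,2) in auto)
  then have arc: "orbit_order (n+1) f ((f ^^ k) x) \<in> patterns (n+1) f" for k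
    using infinite_orbit_funpow[OF assms(3), of k] unfolding patterns_def orbit_order_def by blast
  \<comment> \<open>Only endpoints of arcs are vertices here, so the start is exhibited as the tail
    of the arc at \<open>x\<close>.\<close>
  have "orbit_order n f x \<in> rho n ` patterns (n+1) f"
    using rho_orbit_order[OF assms(3), of n] arc[of 0] by (metis funpow_0 imageI)
  moreover have "set (orbit_arcs n f x l) \<subseteq> patterns (n+1) f"
    using arc by (auto simp: orbit_arcs_def)
  moreover have "pre_digraph.cas (pattern_digraph n f) (orbit_order n f x) (orbit_arcs n f x l)
      (orbit_order n f ((f ^^ l) x))"
    by (rule orbit_cas[OF assms(3)]) (simp_all add: pattern_digraph_def)
  ultimately show ?thesis
    unfolding pre_digraph.awalk_def by (simp add: pattern_digraph_def)
qed

section \<open>The order of a path that follows an orbit\<close>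

lemma path_gen_orbit:
  assumes "infinite (orbit f x)"
    and "(i, j) \<in> path_gen n (orbit_order n f x) (orbit_arcs n f x l)"
  shows "i \<le> j + n \<and> j \<le> i + n \<and> (f ^^ (i - 1)) x \<le> (f ^^ (j - 1)) x"
  using assms(2) unfolding path_gen_def
proof (elim UnE CollectE exE conjE)
  fix a c d
  assume "(i, j) = (a + c, a + d)" "a \<le> length (orbit_arcs n f x l)" "c \<in> {1..n}" "d \<in> {1..n}"
    "(path_verts n (orbit_order n f x) (orbit_arcs n f x l) ! a) c
      \<le> (path_verts n (orbit_order n f x) (orbit_arcs n f x l) ! a) d"
  then show ?thesis
    using path_verts_orbit_arcs[OF assms(1), of a l n] orbit_order_le_iff[OF assms(1), of c n d a]
    by (auto simp: orbit_arcs_def)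
next
  \<comment> \<open>An arc spans \<open>n + 1\<close> consecutive times, which still differ by at
    most \<open>n\<close>.\<close>
  fix a c d
  assume "(i, j) = (a - 1 + c, a - 1 + d)" "1 \<le> a" "a \<le> length (orbit_arcs n f x l)"
    "c \<in> {1..n+1}" "d \<in> {1..n+1}"
    "(orbit_arcs n f x l ! (a - 1)) c \<le> (orbit_arcs n f x l ! (a - 1)) d"
  then show ?thesis
    using orbit_order_le_iff[OF assms(1), of c "n+1" d "a - 1"]
    by (auto simp: orbit_arcs_def)
qed

text \<open>The first element of the chain that is not below \<open>m\<close> exceeds its
  predecessor, which is below \<open>m\<close>, by at most \<open>n\<close>; so it cannot jump over
  the window.\<close>

lemma rtrancl_window:
  fixes a b m n :: nat
  assumes "(a, b) \<in> R\<^sup>*" "a < m" "m + n \<le> b"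
    and "\<And>i j. (i, j) \<in> R \<Longrightarrow> j \<le> i + n"
  shows "\<exists>j\<in>{m..<m+n}. (a, j) \<in> R\<^sup>* \<and> (j, b) \<in> R\<^sup>*"
  using assms(1,2)
proof (induction rule: converse_rtrancl_induct)
  case base
  then show ?case using assms(3) by linarith
next
  case (step a c)
  show ?case
  proof (cases "c < m")
    case True
    then show ?thesis using step by (meson converse_rtrancl_into_rtrancl)
  next
    case False
    then have "c \<in> {m..<m+n}" using step assms(4)[of a c] by auto
    then show ?thesis using step by blast
  qed
qed

text \<open>The value where the chain meets the window is at most the value at the upper end of the
  chain. This may be either end, hence the maximum.\<close>

lemma orbit_path_order_window:
  assumes "infinite (orbit f x)" and m: "i < m" "m + n \<le> j"
    and "R = path_order n (orbit_order n f x) (orbit_arcs n f x l)"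
    and "(i, j) \<in> R \<or> (j, i) \<in> R"
  shows "\<exists>k\<in>{m..<m+n}. (f ^^ (k - 1)) x \<le> max ((f ^^ (i - 1)) x) ((f ^^ (j - 1)) x)"
proof -
  let ?P = "path_gen n (orbit_order n f x) (orbit_arcs n f x l)"
  have mono: "(f ^^ (s - 1)) x \<le> (f ^^ (t - 1)) x" if "(s, t) \<in> ?P\<^sup>*" for s t
    using that by induction (use path_gen_orbit[OF assms(1)] in \<open>auto intro: order_trans\<close>)
  \<comment> \<open>Reversing the relation lets the chain run from \<open>i\<close> to
    \<open>j\<close> in both cases; the step bound is symmetric.\<close>
  from assms(4,5) consider "(i, j) \<in> ?P\<^sup>*" | "(i, j) \<in> (?P\<inverse>)\<^sup>*"
    by (auto simp: path_order_def rtrancl_converse)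
  then show ?thesis
  proof cases
    case 1
    then obtain k where "k \<in> {m..<m+n}" "(k, j) \<in> ?P\<^sup>*"
      using rtrancl_window[OF 1 m] path_gen_orbit[OF assms(1)] by blast
    then show ?thesis using mono unfolding le_max_iff_disj by blast
  next
    case 2
    then obtain k where "k \<in> {m..<m+n}" "(i, k) \<in> (?P\<inverse>)\<^sup>*"
      using rtrancl_window[OF 2 m] path_gen_orbit[OF assms(1)] by blast
    then show ?thesis using mono unfolding le_max_iff_disj rtrancl_converse by blast
  qed
qed

section \<open>Construction of the loop\<close>

theorem theorem6p5:
  fixes f :: "real \<Rightarrow> real" and n :: nat
  assumes "f \<in> class_A" and "ergodic (lebesgue_on {0..1}) f" and "n \<ge> 1"
  shows "\<exists>u es. is_loop (pattern_digraph n f) u es \<and> partially_driftless n u es"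
proof -
  define M where "M = lebesgue_on {0..1::real}"
  \<comment> \<open>The threshold is positive, so low points have positive measure, and
    \<open>real n * c < 1\<close> leaves room for the union bound.\<close>
  define c where "c = 1 / (real n + 1)"
  have c: "0 < c" "c \<le> 1" "real n * c < 1" by (auto simp: c_def field_simps)
  have fin: "finite_measure M"
    by standard (simp add: M_def emeasure_restrict_space)
  have maps: "f \<in> {0..1} \<rightarrow> {0..1}" using assms(1) by (simp add: class_A_def)
  have "AE x in M. infinite (orbit f x)" using assms(1) unfolding class_A_def M_def by blast
  moreover have "AE x in M. \<exists>\<^sub>F k in sequentially. (f ^^ k) x \<in> {0..<c}"
    using assms(2) fin c emeasure_lebesgue_unit[of c]
    by (intro ergodic_visits_infinitely_often) (auto simp: M_def sets_restrict_space_iff)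
  moreover have "AE x in M. \<exists>\<^sub>F k in sequentially. \<forall>i<n. (f ^^ (k + i)) x \<ge> c"
    unfolding M_def using ergodic_unit_interval_avoids[OF assms(2)] c by simp
  ultimately have "AE x in M. infinite (orbit f x) \<and>
      (\<exists>\<^sub>F k in sequentially. (f ^^ k) x \<in> {0..<c}) \<and>
      (\<exists>\<^sub>F k in sequentially. \<forall>i<n. (f ^^ (k + i)) x \<ge> c)"
    by eventually_elim auto
  \<comment> \<open>The measure is nonzero, so an almost sure property has a witness.\<close>
  moreover have "ae_filter M \<noteq> bot"
    by (simp add: ae_filter_eq_bot_iff M_def emeasure_restrict_space)
  ultimately obtain x where x: "x \<in> space M" "infinite (orbit f x)"
    and low: "\<exists>\<^sub>F k in sequentially. (f ^^ k) x \<in> {0..<c}"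
    and high: "\<exists>\<^sub>F k in sequentially. \<forall>i<n. (f ^^ (k + i)) x \<ge> c"
    using eventually_happens[OF eventually_conj[OF AE_space]] by blast
  let ?K = "{k. (f ^^ k) x \<in> {0..<c}}"
  have "infinite ?K" using low by (simp add: frequently_cofinite flip: cofinite_eq_sequentially)
  moreover have "finite ((\<lambda>k. orbit_order n f ((f ^^ k) x)) ` ?K)"
    by (rule finite_subset[OF _ finite_permutations[of "{1..n}"]])
      (use orbit_order_permutes[OF infinite_orbit_funpow[OF x(2)]] in auto)
  \<comment> \<open>Infinitely many repetitions of the pattern are kept, so that the second low time
    can be chosen after a non-low window following \<open>p\<close>.\<close>
  ultimately obtain p where p: "p \<in> ?K"
    and inf: "infinite {k \<in> ?K. orbit_order n f ((f ^^ k) x) = orbit_order n f ((f ^^ p) x)}"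
    using pigeonhole_infinite by blast
  obtain b where b: "b > p" "\<And>i. i < n \<Longrightarrow> (f ^^ (b + i)) x \<ge> c"
    using high unfolding frequently_sequentially by (metis Suc_le_eq)
  obtain q where q: "q \<ge> b + n" "(f ^^ q) x \<in> {0..<c}"
    and eq: "orbit_order n f ((f ^^ q) x) = orbit_order n f ((f ^^ p) x)"
    using inf unfolding infinite_nat_iff_unbounded_le by blast
  define y where "y = (f ^^ p) x"
  define l where "l = q - p"
  have shift: "(f ^^ k) y = (f ^^ (k + p)) x" for k by (simp add: y_def funpow_add)
  have l: "l \<ge> 1" "(f ^^ l) y = (f ^^ q) x" using q b by (auto simp: l_def shift)
  have y: "y \<in> {0..1}" "infinite (orbit f y)"
    using p c infinite_orbit_funpow[OF x(2)] by (auto simp: y_def)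
  define u es where "u = orbit_order n f y" and "es = orbit_arcs n f y l"
  have len: "length es = l" by (simp add: es_def orbit_arcs_def)
  have "is_loop (pattern_digraph n f) u es"
    using awalk_orbit[OF maps y l(1), of n] eq l(2) by (simp add: is_loop_def u_def es_def y_def)
  \<comment> \<open>The driftless index is 1: indices \<open>1\<close> and \<open>l + 1\<close>
    stand for the two low points, at times \<open>p\<close> and \<open>q\<close> of the orbit of
    \<open>x\<close>.\<close>
  moreover have "drift n u es 1 = Drift_Zero"
  proof -
    have "\<not> ((1, l + 1) \<in> path_order n u es \<or> (l + 1, 1) \<in> path_order n u es)"
    proof
      assume "(1, l + 1) \<in> path_order n u es \<or> (l + 1, 1) \<in> path_order n u es"
      \<comment> \<open>Time \<open>b\<close> in the orbit of \<open>x\<close> is time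
        \<open>b - p\<close> in that of \<open>y\<close>, hence index \<open>b - p + 1\<close>. The
        choices \<open>b > p\<close> and \<open>q \<ge> b + n\<close> put the window strictly
        between the two ends.\<close>
      then have "\<exists>k\<in>{b - p + 1..<b - p + 1 + n}.
          (f ^^ (k - 1)) y \<le> max ((f ^^ (1 - 1)) y) ((f ^^ (l + 1 - 1)) y)"
        using b(1) q(1) unfolding u_def es_def
        by (intro orbit_path_order_window[OF y(2) _ _ refl]) (auto simp: l_def)
      then obtain k where k: "k \<in> {b - p + 1..<b - p + 1 + n}"
        "(f ^^ (k - 1)) y \<le> max ((f ^^ (1 - 1)) y) ((f ^^ (l + 1 - 1)) y)"
        by blast
      have "k - 1 + p = b + (k - 1 + p - b)" "k - 1 + p - b < n" using k(1) b(1) by auto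
      then have "(f ^^ (k - 1)) y \<ge> c" unfolding shift by (metis b(2))
      moreover have "(f ^^ (k - 1)) y < c" using k(2) p q(2) l(2) by (auto simp: y_def max_def split: if_splits)
      ultimately show False by simp
    qed
    then show ?thesis by (simp add: drift_def len)
  qed
  ultimately show ?thesis
    using l(1) len assms(3) unfolding partially_driftless_def by (metis atLeastAtMost_iff order_refl)
qed

end
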